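(* Let $X$ be a $W$-space, $C\subseteq X$ a convex subset, $T:C\to C$ a nonexpansive mapping, $u,x_0,y_0\in C$, and let $(\beta_n)_{n\in\mathbb N},(\lambda_n)_{n\in\mathbb N}$ be sequences in $[0,1]$. Let $(x_n)$ be the Tikhonov-Mann iteration starting with $x_0$ and $(y_n)$ the modified Halpern iteration starting with $y_0$, i.e. for all $n\in\mathbb N$ $$x_{n+1}=(1-\lambda_n)u_n+\lambda_n Tu_n,\qquad u_n=(1-\beta_n)u+\beta_n x_n,$$ $$y_{n+1}=(1-\beta_{n+1})u+\beta_{n+1}v_n,\qquad v_n=(1-\lambda_n)y_n+\lambda_n Ty_n.$$ Assume that $y_0=(1-\beta_0)u+\beta_0x_0$. Then for all $n\in\mathbb N$, $$u_n=y_n\quad\text{and}\quad x_{n+1}=v_n.$$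
   Context: A $W$-space is a metric space $(X,d)$ together with a function $W:X\times X\times[0,1]\to X$ (no axioms on $W$ are assumed). One writes $(1-\lambda)x+\lambda y$ for $W(x,y,\lambda)$. A nonempty subset $C\subseteq X$ is convex if $(1-\lambda)x+\lambda y\in C$ for all $x,y\in C$ and $\lambda\in[0,1]$. $T:C\to C$ is nonexpansive if $d(Tx,Ty)\le d(x,y)$ for all $x,y\in C$. *)

theory Defs
  imports "HOL-Analysis.Analysis"
begin

text \<open>
  \<open>W x y t\<close> is the point written \<open>(1 - t) x + t y\<close>. Beyond the closure of \<open>X\<close> nothing
  is assumed about \<open>W\<close>; its values outside \<open>X \<times> X \<times> [0,1]\<close> are irrelevant.
\<close>

locale W_space = Metric_space X d
  for X :: "'a set" and d :: "'a \<Rightarrow> 'a \<Rightarrow> real" +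
  fixes W :: "'a \<Rightarrow> 'a \<Rightarrow> real \<Rightarrow> 'a"
  assumes W_closed: "\<lbrakk>x \<in> X; y \<in> X; t \<in> {0..1}\<rbrakk> \<Longrightarrow> W x y t \<in> X"

definition W_convex :: "'a set \<Rightarrow> ('a \<Rightarrow> 'a \<Rightarrow> real \<Rightarrow> 'a) \<Rightarrow> 'a set \<Rightarrow> bool" where
  "W_convex X W C \<longleftrightarrow>
     C \<noteq> {} \<and> C \<subseteq> X \<and> (\<forall>x\<in>C. \<forall>y\<in>C. \<forall>t\<in>{0..1}. W x y t \<in> C)"

definition nonexpansive_on :: "('a \<Rightarrow> 'a \<Rightarrow> real) \<Rightarrow> 'a set \<Rightarrow> ('a \<Rightarrow> 'a) \<Rightarrow> bool" where
  "nonexpansive_on d C T \<longleftrightarrow>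
     T \<in> C \<rightarrow> C \<and> (\<forall>x\<in>C. \<forall>y\<in>C. d (T x) (T y) \<le> d x y)"

text \<open>
  Both iterations are predicates on the main sequence (\<open>x\<close>, resp. \<open>y\<close>) together with its
  auxiliary sequence (\<open>un\<close>, resp. \<open>v\<close>); the starting point determines both sequences.
\<close>

definition tikhonov_mann ::
  "('a \<Rightarrow> 'a \<Rightarrow> real \<Rightarrow> 'a) \<Rightarrow> ('a \<Rightarrow> 'a) \<Rightarrow> 'a \<Rightarrow> (nat \<Rightarrow> real) \<Rightarrow> (nat \<Rightarrow> real) \<Rightarrow> 'a
    \<Rightarrow> (nat \<Rightarrow> 'a) \<Rightarrow> (nat \<Rightarrow> 'a) \<Rightarrow> bool" where
  "tikhonov_mann W T u \<beta> lam x0 x un \<longleftrightarrow>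
     x 0 = x0 \<and>
     (\<forall>n. x (Suc n) = W (un n) (T (un n)) (lam n)) \<and>
     (\<forall>n. un n = W u (x n) (\<beta> n))"

definition modified_halpern ::
  "('a \<Rightarrow> 'a \<Rightarrow> real \<Rightarrow> 'a) \<Rightarrow> ('a \<Rightarrow> 'a) \<Rightarrow> 'a \<Rightarrow> (nat \<Rightarrow> real) \<Rightarrow> (nat \<Rightarrow> real) \<Rightarrow> 'a
    \<Rightarrow> (nat \<Rightarrow> 'a) \<Rightarrow> (nat \<Rightarrow> 'a) \<Rightarrow> bool" where
  "modified_halpern W T u \<beta> lam y0 y v \<longleftrightarrow>
     y 0 = y0 \<and>
     (\<forall>n. y (Suc n) = W u (v n) (\<beta> (Suc n))) \<and>
     (\<forall>n. v n = W (y n) (T (y n)) (lam n))"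

end

theory Submission
  imports Defs
begin

text \<open>Both schemes alternate the same two maps, the anchoring \<open>W u z (\<beta> n)\<close>
  and the Mann step \<open>W z (T z) (lam n)\<close>; they differ only in which intermediate point
  is called the main sequence. The choice of \<open>y0\<close> lets \<open>y\<close> start just
  after the first anchoring, so induction keeps the two orbits in step, by rewriting alone.\<close>

theorem proposition3p2:
  fixes X C :: "'a set"
    and d :: "'a \<Rightarrow> 'a \<Rightarrow> real"
    and W :: "'a \<Rightarrow> 'a \<Rightarrow> real \<Rightarrow> 'a"
    and T :: "'a \<Rightarrow> 'a"
    and u x0 y0 :: 'a
    and \<beta> lam :: "nat \<Rightarrow> real"
    and x un y v :: "nat \<Rightarrow> 'a"
  assumes "W_space X d W"
    and "W_convex X W C"
    and "nonexpansive_on d C T"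
    and "u \<in> C" and "x0 \<in> C" and "y0 \<in> C"
    and "\<forall>n. \<beta> n \<in> {0..1}"
    and "\<forall>n. lam n \<in> {0..1}"
    and "tikhonov_mann W T u \<beta> lam x0 x un"
    and "modified_halpern W T u \<beta> lam y0 y v"
    and "y0 = W u x0 (\<beta> 0)"
  shows "\<forall>n. un n = y n \<and> x (Suc n) = v n"
proof -
  have un: "un n = W u (x n) (\<beta> n)" and xS: "x (Suc n) = W (un n) (T (un n)) (lam n)" for n
    using assms(9) by (simp_all add: tikhonov_mann_def)
  have yS: "y (Suc n) = W u (v n) (\<beta> (Suc n))" and v: "v n = W (y n) (T (y n)) (lam n)" for n
    using assms(10) by (simp_all add: modified_halpern_def)
  have "un n = y n" for n
  proof (induction n)
    case 0
    show ?case
      using assms(9-11) un[of 0] by (simp add: tikhonov_mann_def modified_halpern_def)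
  next
    case (Suc n)
    \<comment> \<open>Equal points \<open>un n\<close> and \<open>y n\<close> have equal Mann steps;
      anchoring these with the same weight \<open>\<beta> (Suc n)\<close> then gives
      \<open>un (Suc n)\<close> and \<open>y (Suc n)\<close>.\<close>
    have "x (Suc n) = v n"
      by (simp only: xS v Suc.IH)
    then show ?case
      by (simp only: un yS)
  qed
  then show ?thesis
    by (simp only: xS v) simp
qed

end
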